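(* Let $d\ge1$. There exist constants $C>0$ and $n_0$ (depending only on $d$) such that for all integers $n\ge n_0$, $$\overleftarrow{m}_{mon}(\mathbb{T}_n^d,maj)\le\Big(1-\frac{d}{d+2}\Big)n^d+Cn^{d-1}.$$
   Context: The $d$-dimensional torus $\mathbb{T}_n^d$ is the graph with vertex set $[n]^d=\{1,\dots,n\}^d$, where two vertices are adjacent iff they differ in exactly one coordinate $j$ and in that coordinate $x_j-x'_j\equiv\pm1\pmod n$. A configuration assigns each vertex a state active (1) or inactive (0); its size is the number of active vertices. Majority process: in each round, simultaneously, vertex $v$ becomes active if (number of active neighbors of $v$) $+\omega_v/2>\deg(v)/2$ and inactive otherwise (majority of neighbors, keeping its own state in case of a tie). A dynamo is an initial configuration $\omega^{(0)}$ such that from some time on all vertices are active forever; it is monotone if moreover $\omega^{(t+1)}\ge\omega^{(t)}$ coordinatewise for all $t\ge0$. $\overleftarrow{m}_{mon}(G,maj)$ is the minimum size of a monotone dynamo under the majority process on $G$. *)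

theory Defs
  imports Complex_Main "HOL-Library.FuncSet" "HOL-Number_Theory.Cong"
begin

text \<open>A graph is a vertex set together with an adjacency predicate (only its values on the
  vertex set matter).\<close>

type_synonym 'a graph = "'a set \<times> ('a \<Rightarrow> 'a \<Rightarrow> bool)"

abbreviation vertices :: "'a graph \<Rightarrow> 'a set" where
  "vertices G \<equiv> fst G"

definition neighbors :: "'a graph \<Rightarrow> 'a \<Rightarrow> 'a set" where
  "neighbors G v = {u \<in> vertices G. snd G v u}"

definition degree :: "'a graph \<Rightarrow> 'a \<Rightarrow> nat" where
  "degree G v = card (neighbors G v)"

definition torus :: "nat \<Rightarrow> nat \<Rightarrow> (nat \<Rightarrow> nat) graph" where
  "torus d n =
     ({1..d} \<rightarrow>\<^sub>E {1..n},
      \<lambda>x y. \<exists>j\<in>{1..d}. x j \<noteq> y j \<and> (\<forall>i\<in>{1..d} - {j}. x i = y i) \<and>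
        ([int (x j) - int (y j) = 1] (mod int n) \<or> [int (x j) - int (y j) = - 1] (mod int n)))"

definition configurations :: "'a graph \<Rightarrow> ('a \<Rightarrow> nat) set" where
  "configurations G = vertices G \<rightarrow>\<^sub>E {0, 1}"

definition config_size :: "'a graph \<Rightarrow> ('a \<Rightarrow> nat) \<Rightarrow> nat" where
  "config_size G \<omega> = card {v \<in> vertices G. \<omega> v = 1}"

text \<open>A process maps a graph to its (synchronous) one-round update of configurations.\<close>

type_synonym 'a process = "'a graph \<Rightarrow> ('a \<Rightarrow> nat) \<Rightarrow> ('a \<Rightarrow> nat)"

definition maj :: "'a process" where
  "maj G \<omega> = (\<lambda>v\<in>vertices G.
     if real (card {u \<in> neighbors G v. \<omega> u = 1}) + real (\<omega> v) / 2 > real (degree G v) / 2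
     then 1 else 0)"

definition dynamo :: "'a graph \<Rightarrow> 'a process \<Rightarrow> ('a \<Rightarrow> nat) \<Rightarrow> bool" where
  "dynamo G P \<omega> \<longleftrightarrow> \<omega> \<in> configurations G \<and>
     (\<exists>T. \<forall>t\<ge>T. \<forall>v\<in>vertices G. (P G ^^ t) \<omega> v = 1)"

definition monotone_dynamo :: "'a graph \<Rightarrow> 'a process \<Rightarrow> ('a \<Rightarrow> nat) \<Rightarrow> bool" where
  "monotone_dynamo G P \<omega> \<longleftrightarrow> dynamo G P \<omega> \<and>
     (\<forall>t. \<forall>v\<in>vertices G. (P G ^^ t) \<omega> v \<le> (P G ^^ Suc t) \<omega> v)"

definition m_mon :: "'a graph \<Rightarrow> 'a process \<Rightarrow> nat" where
  "m_mon G P = (LEAST k. \<exists>\<omega>. monotone_dynamo G P \<omega> \<and> config_size G \<omega> = k)"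

text \<open>The minimum defining \<open>m_mon G maj\<close> is over a nonempty set: the all-active configuration
  is always a monotone dynamo.\<close>

lemma monotone_dynamo_all_active: "monotone_dynamo G maj (\<lambda>v\<in>vertices G. 1)"
proof -
  let ?one = "\<lambda>v\<in>vertices G. 1 :: nat"
  have "{u \<in> neighbors G v. ?one u = 1} = neighbors G v" for v
    by (auto simp: neighbors_def)
  then have "maj G ?one = ?one"
    by (auto simp: maj_def degree_def fun_eq_iff restrict_def)
  then have "(maj G ^^ t) ?one = ?one" for t
    by (induction t) simp_all
  then show ?thesis
    by (auto simp: monotone_dynamo_def dynamo_def configurations_def simp del: funpow.simps)
qed

lemma m_mon_attained: "\<exists>\<omega>. monotone_dynamo G maj \<omega> \<and> config_size G \<omega> = m_mon G maj"
  unfolding m_mon_def by (rule LeastI_ex) (use monotone_dynamo_all_active in blast)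

end

theory Submission
  imports Defs
begin

text \<open>Call \<open>x\<^sub>1 + \<dots> + x\<^sub>d\<close> the level of \<open>x\<close>. Initially the vertices whose level is \<open>0\<close>
  or \<open>-1\<close> modulo \<open>d + 2\<close> are active, together with the boundary of the box \<open>[n]\<^sup>d\<close>, which
  contributes only \<open>O(n\<^bsup>d-1\<^esup>)\<close>. Every active vertex then has at least \<open>d\<close> active neighbours.
  Give a vertex of level \<open>k\<close> modulo \<open>d + 2\<close>, where \<open>0 \<le> k \<le> d + 1\<close>, the rank
  \<open>2 \<Sum> j x\<^sub>j - k\<^sup>2\<close>. An inactive vertex has \<open>1 \<le> k \<le> d\<close>. Stepping up from it in direction
  \<open>j\<close> changes the rank by \<open>2j - (2k + 1)\<close>, which is negative for \<open>j \<le> k\<close>; stepping down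
  changes it by \<open>(2k - 1) - 2j\<close>, which is negative for \<open>j \<ge> k\<close>. Hence
  \<open>k + (d - k + 1) = d + 1\<close> of the \<open>2d\<close> neighbours have smaller rank, and the vertices become
  active in the order of their rank.\<close>

subsection \<open>Monotone dynamos of the majority process\<close>

lemma finite_neighbors: "finite (vertices G) \<Longrightarrow> finite (neighbors G v)"
  by (simp add: neighbors_def)

lemma configurations_le_1:
  assumes "\<omega> \<in> configurations G" "v \<in> vertices G"
  shows "\<omega> v \<le> 1"
  using PiE_mem[OF assms[unfolded configurations_def]] by auto

lemma maj_in_configurations: "maj G \<omega> \<in> configurations G"
  by (auto simp: maj_def configurations_def)

lemma maj_funpow_in_configurations:
  assumes "\<omega> \<in> configurations G"
  shows "(maj G ^^ t) \<omega> \<in> configurations G"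
  using assms by (cases t) (simp_all add: maj_in_configurations)

lemma maj_active_iff:
  assumes "v \<in> vertices G"
  shows "maj G \<omega> v = 1 \<longleftrightarrow> degree G v < 2 * card {u \<in> neighbors G v. \<omega> u = 1} + \<omega> v"
proof -
  have "real (degree G v) / 2 < real (card {u \<in> neighbors G v. \<omega> u = 1}) + real (\<omega> v) / 2
    \<longleftrightarrow> real (degree G v) < real (2 * card {u \<in> neighbors G v. \<omega> u = 1} + \<omega> v)"
    by (simp add: field_simps)
  then show ?thesis
    using assms by (simp only: maj_def restrict_apply of_nat_less_iff) simp
qed

lemma configurations_le_iff:
  assumes "\<omega> \<in> configurations G" "\<omega>' \<in> configurations G"
  shows "\<omega> \<le> \<omega>' \<longleftrightarrow> (\<forall>v\<in>vertices G. \<omega> v = 1 \<longrightarrow> \<omega>' v = 1)"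
proof
  show "\<forall>v\<in>vertices G. \<omega> v = 1 \<longrightarrow> \<omega>' v = 1" if "\<omega> \<le> \<omega>'"
    using that configurations_le_1[OF assms(2)] by (metis le_antisym le_funD)
next
  assume active: "\<forall>v\<in>vertices G. \<omega> v = 1 \<longrightarrow> \<omega>' v = 1"
  show "\<omega> \<le> \<omega>'"
  proof (rule le_funI)
    fix v
    show "\<omega> v \<le> \<omega>' v"
    proof (cases "v \<in> vertices G")
      case True
      then have "\<omega> v = 0 \<or> \<omega> v = 1" using configurations_le_1[OF assms(1)] by force
      then show ?thesis using active True by auto
    next
      case False
      then show ?thesis
        using assms PiE_arb unfolding configurations_def by (metis order_refl)
    qed
  qed
qed

lemma maj_mono:
  assumes fin: "finite (vertices G)"
    and conf: "\<omega> \<in> configurations G" "\<omega>' \<in> configurations G" and le: "\<omega> \<le> \<omega>'"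
  shows "maj G \<omega> \<le> maj G \<omega>'"
  unfolding configurations_le_iff[OF maj_in_configurations maj_in_configurations]
proof (intro ballI impI)
  fix v assume v: "v \<in> vertices G" and active: "maj G \<omega> v = 1"
  have "{u \<in> neighbors G v. \<omega> u = 1} \<subseteq> {u \<in> neighbors G v. \<omega>' u = 1}"
    using le configurations_le_iff[OF conf] by (auto simp: neighbors_def)
  then have "card {u \<in> neighbors G v. \<omega> u = 1} \<le> card {u \<in> neighbors G v. \<omega>' u = 1}"
    using finite_neighbors[OF fin] by (intro card_mono) auto
  then show "maj G \<omega>' v = 1"
    using active le_funD[OF le, of v] unfolding maj_active_iff[OF v] by linarith
qed

lemma incseq_maj_funpow:
  assumes "finite (vertices G)" "\<omega> \<in> configurations G" "\<omega> \<le> maj G \<omega>"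
  shows "incseq (\<lambda>t. (maj G ^^ t) \<omega>)"
proof (rule incseq_SucI)
  show "(maj G ^^ t) \<omega> \<le> (maj G ^^ Suc t) \<omega>" for t
  proof (induction t)
    case (Suc t)
    have "maj G ((maj G ^^ t) \<omega>) \<le> maj G ((maj G ^^ Suc t) \<omega>)"
      using Suc assms by (intro maj_mono maj_funpow_in_configurations)
    then show ?case by simp
  qed (use assms in simp)
qed

lemma incseq_eventually_active:
  assumes "incseq \<omega>" "\<And>t. \<omega> t \<in> configurations G" "v \<in> vertices G" "\<omega> t v = 1"
  shows "\<forall>\<^sub>F s in sequentially. \<omega> s v = 1"
  using eventually_ge_at_top[of t]
proof eventually_elim
  case (elim s)
  then have "\<omega> t \<le> \<omega> s" by (rule incseqD[OF assms(1)])
  then show ?case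
    using assms by (metis configurations_le_iff)
qed

lemma maj_eventually_active:
  assumes fin: "finite (vertices G)" and conf: "\<omega> \<in> configurations G"
    and inc: "incseq (\<lambda>t. (maj G ^^ t) \<omega>)" and v: "v \<in> vertices G"
    and N: "N \<subseteq> neighbors G v" "degree G v < 2 * card N"
    and active: "\<And>u. u \<in> N \<Longrightarrow> \<forall>\<^sub>F t in sequentially. (maj G ^^ t) \<omega> u = 1"
  shows "\<forall>\<^sub>F t in sequentially. (maj G ^^ t) \<omega> v = 1"
proof -
  have "finite N"
    using N(1) finite_neighbors[OF fin] by (rule finite_subset)
  then have "\<forall>\<^sub>F t in sequentially. \<forall>u\<in>N. (maj G ^^ t) \<omega> u = 1"
    using active by (intro eventually_ball_finite) auto
  then obtain t where t: "\<forall>u\<in>N. (maj G ^^ t) \<omega> u = 1"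
    by (auto simp: eventually_sequentially)
  then have "card N \<le> card {u \<in> neighbors G v. (maj G ^^ t) \<omega> u = 1}"
    using N(1) finite_neighbors[OF fin] by (intro card_mono) auto
  then have "maj G ((maj G ^^ t) \<omega>) v = 1"
    unfolding maj_active_iff[OF v] using N(2) by linarith
  then have "(maj G ^^ Suc t) \<omega> v = 1" by simp
  then show ?thesis
    by (rule incseq_eventually_active[OF inc maj_funpow_in_configurations[OF conf] v])
qed

lemma monotone_dynamoI:
  assumes "finite (vertices G)" "\<omega> \<in> configurations G"
    and "incseq (\<lambda>t. (P G ^^ t) \<omega>)"
    and "\<And>v. v \<in> vertices G \<Longrightarrow> \<forall>\<^sub>F t in sequentially. (P G ^^ t) \<omega> v = 1"
  shows "monotone_dynamo G P \<omega>"
proof -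
  have "\<forall>\<^sub>F t in sequentially. \<forall>v\<in>vertices G. (P G ^^ t) \<omega> v = 1"
    using assms by (intro eventually_ball_finite) auto
  then have "dynamo G P \<omega>"
    using assms(2) by (simp add: dynamo_def eventually_sequentially)
  then show ?thesis
    using incseq_SucD[OF assms(3)] by (simp add: monotone_dynamo_def le_fun_def)
qed

definition indicator_config :: "'a graph \<Rightarrow> 'a set \<Rightarrow> 'a \<Rightarrow> nat" where
  "indicator_config G A = (\<lambda>v\<in>vertices G. of_bool (v \<in> A))"

lemma indicator_config_in_configurations: "indicator_config G A \<in> configurations G"
  by (auto simp: indicator_config_def configurations_def)

lemma indicator_config_eq_1_iff:
  "v \<in> vertices G \<Longrightarrow> indicator_config G A v = 1 \<longleftrightarrow> v \<in> A"
  by (simp add: indicator_config_def)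

lemma config_size_indicator_config:
  "config_size G (indicator_config G A) = card (vertices G \<inter> A)"
  unfolding config_size_def
  by (rule arg_cong[where f = card]) (auto simp: indicator_config_eq_1_iff simp del: One_nat_def)

lemma indicator_config_le_maj:
  assumes "\<And>v. v \<in> vertices G \<Longrightarrow> v \<in> A \<Longrightarrow>
    degree G v \<le> 2 * card {u \<in> neighbors G v. u \<in> A}"
  shows "indicator_config G A \<le> maj G (indicator_config G A)"
  unfolding configurations_le_iff[OF indicator_config_in_configurations maj_in_configurations]
proof (intro ballI impI)
  fix v assume v: "v \<in> vertices G" and active: "indicator_config G A v = 1"
  have "{u \<in> neighbors G v. indicator_config G A u = 1} = {u \<in> neighbors G v. u \<in> A}"
    by (auto simp: neighbors_def indicator_config_eq_1_iff simp del: One_nat_def)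
  moreover have "degree G v \<le> 2 * card {u \<in> neighbors G v. u \<in> A}"
    using assms v active indicator_config_eq_1_iff by metis
  ultimately show "maj G (indicator_config G A) v = 1"
    unfolding maj_active_iff[OF v] active by simp
qed

lemma monotone_dynamo_indicator_config:
  fixes rank :: "'a \<Rightarrow> 'b::order"
  assumes fin: "finite (vertices G)"
    and stable: "\<And>v. v \<in> vertices G \<Longrightarrow> v \<in> A \<Longrightarrow>
      degree G v \<le> 2 * card {u \<in> neighbors G v. u \<in> A}"
    and growth: "\<And>v. v \<in> vertices G \<Longrightarrow> v \<notin> A \<Longrightarrow>
      degree G v < 2 * card {u \<in> neighbors G v. u \<in> A \<or> rank u < rank v}"
  shows "monotone_dynamo G maj (indicator_config G A)"
proof -
  let ?\<omega> = "indicator_config G A"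
  note conf = indicator_config_in_configurations[of G A]
  have inc: "incseq (\<lambda>t. (maj G ^^ t) ?\<omega>)"
    by (intro incseq_maj_funpow fin conf indicator_config_le_maj stable)
  have seed_active: "\<forall>\<^sub>F t in sequentially. (maj G ^^ t) ?\<omega> v = 1"
    if "v \<in> vertices G" "v \<in> A" for v
    using incseq_eventually_active[OF inc maj_funpow_in_configurations[OF conf], of v 0] that
    by (simp add: indicator_config_def)
  have wf: "wfp_on (vertices G) (\<lambda>u v. rank u < rank v)"
    by (intro strict_partial_order_wfp_on_finite_set transp_onI asymp_onI fin) auto
  have "\<forall>\<^sub>F t in sequentially. (maj G ^^ t) ?\<omega> v = 1" if "v \<in> vertices G" for v
    using wf
  proof (induction v rule: wfp_on_induct)
    case in_set
    show ?case by (rule that)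
  next
    case (less v)
    show ?case
    proof (cases "v \<in> A")
      case True
      then show ?thesis by (rule seed_active[OF less.hyps])
    next
      case False
      show ?thesis
      proof (rule maj_eventually_active[OF fin conf inc less.hyps _ growth[OF less.hyps False]])
        show "\<forall>\<^sub>F t in sequentially. (maj G ^^ t) ?\<omega> u = 1"
          if "u \<in> {u \<in> neighbors G v. u \<in> A \<or> rank u < rank v}" for u
          using that less.IH seed_active unfolding neighbors_def by blast
      qed blast
    qed
  qed
  with fin conf inc show ?thesis by (rule monotone_dynamoI)
qed

lemma m_mon_le_config_size:
  assumes "monotone_dynamo G P \<omega>"
  shows "m_mon G P \<le> config_size G \<omega>"
  unfolding m_mon_def using assms by (intro Least_le) blast

subsection \<open>Neighbourhoods in the torus\<close>

lemma vertices_torus: "vertices (torus d n) = {1..d} \<rightarrow>\<^sub>E {1..n}"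
  by (simp add: torus_def)

lemma vertices_torus_mem: "x \<in> vertices (torus d n) \<Longrightarrow> j \<in> {1..d} \<Longrightarrow> x j \<in> {1..n}"
  by (auto simp: vertices_torus)

lemma finite_vertices_torus: "finite (vertices (torus d n))"
  by (simp add: vertices_torus finite_PiE)

definition torus_succ :: "nat \<Rightarrow> 'i \<Rightarrow> ('i \<Rightarrow> nat) \<Rightarrow> 'i \<Rightarrow> nat" where
  "torus_succ n j x = x(j := if x j = n then 1 else x j + 1)"

definition torus_pred :: "nat \<Rightarrow> 'i \<Rightarrow> ('i \<Rightarrow> nat) \<Rightarrow> 'i \<Rightarrow> nat" where
  "torus_pred n j x = x(j := if x j = 1 then n else x j - 1)"

lemma torus_succ_pred: "x j \<in> {1..n} \<Longrightarrow> torus_succ n j (torus_pred n j x) = x"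
  by (auto simp: torus_succ_def torus_pred_def fun_eq_iff)

lemma cong_diff_neg_1_iff:
  fixes n s t :: nat
  assumes "s \<in> {1..n}" "t \<in> {1..n}"
  shows "[int s - int t = - 1] (mod int n) \<longleftrightarrow> t = (if s = n then 1 else s + 1)"
proof -
  have "[int s - int t = - 1] (mod int n) \<longleftrightarrow> int n dvd int s - int t + 1"
    by (simp add: cong_iff_dvd_diff)
  also have "\<dots> \<longleftrightarrow> int s - int t + 1 = 0 \<or> int s - int t + 1 = int n"
    using assms dvd_imp_le_int[of "int s - int t + 1" "int n"]
    by (cases "int s - int t + 1 = 0") auto
  also have "\<dots> \<longleftrightarrow> t = (if s = n then 1 else s + 1)"
    using assms by auto
  finally show ?thesis .
qed

lemma cong_diff_1_iff:
  fixes n s t :: nat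
  assumes "s \<in> {1..n}" "t \<in> {1..n}"
  shows "[int s - int t = 1] (mod int n) \<longleftrightarrow> t = (if s = 1 then n else s - 1)"
proof -
  have "[int s - int t = 1] (mod int n) \<longleftrightarrow> [int t - int s = - 1] (mod int n)"
    using cong_minus_minus_iff[of "int s - int t" 1 "int n"] by simp
  also have "\<dots> \<longleftrightarrow> s = (if t = n then 1 else t + 1)"
    by (rule cong_diff_neg_1_iff[OF assms(2,1)])
  also have "\<dots> \<longleftrightarrow> t = (if s = 1 then n else s - 1)"
    using assms by auto
  finally show ?thesis .
qed

lemma neighbors_torus_eq_UN:
  assumes "x \<in> vertices (torus d n)"
  shows "neighbors (torus d n) x = (\<Union>j\<in>{1..d}. (\<lambda>t. x(j := t)) ` {t \<in> {1..n}. t \<noteq> x j \<and>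
    ([int (x j) - int t = 1] (mod int n) \<or> [int (x j) - int t = - 1] (mod int n))})"
    (is "_ = (\<Union>j\<in>_. _ ` ?T j)")
proof (intro equalityI subsetI)
  fix y assume y: "y \<in> neighbors (torus d n) x"
  then have yV: "y \<in> vertices (torus d n)" by (simp add: neighbors_def)
  from y obtain j where j: "j \<in> {1..d}" "\<forall>i\<in>{1..d} - {j}. x i = y i"
    and "x j \<noteq> y j" "[int (x j) - int (y j) = 1] (mod int n) \<or>
      [int (x j) - int (y j) = - 1] (mod int n)"
    by (auto simp: neighbors_def torus_def)
  then have "y j \<in> ?T j" using vertices_torus_mem[OF yV j(1)] by auto
  moreover have "y = x(j := y j)"
  proof
    show "y i = (x(j := y j)) i" for i
      using j assms yV
      by (cases "i \<in> {1..d}") (auto simp: vertices_torus PiE_def extensional_def)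
  qed
  ultimately show "y \<in> (\<Union>j\<in>{1..d}. (\<lambda>t. x(j := t)) ` ?T j)"
    using j(1) by blast
next
  fix y assume "y \<in> (\<Union>j\<in>{1..d}. (\<lambda>t. x(j := t)) ` ?T j)"
  then obtain j t where j: "j \<in> {1..d}" "t \<in> ?T j" and y: "y = x(j := t)" by blast
  then have "y \<in> vertices (torus d n)"
    using assms by (auto simp: vertices_torus PiE_def extensional_def)
  then show "y \<in> neighbors (torus d n) x"
    using j by (auto simp: y neighbors_def torus_def)
qed

lemma neighbors_torus:
  assumes n: "n \<ge> 2" and x: "x \<in> vertices (torus d n)"
  shows "neighbors (torus d n) x =
    (\<lambda>j. torus_succ n j x) ` {1..d} \<union> (\<lambda>j. torus_pred n j x) ` {1..d}"
proof -
  have "{t \<in> {1..n}. t \<noteq> x j \<and>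
      ([int (x j) - int t = 1] (mod int n) \<or> [int (x j) - int t = - 1] (mod int n))}
    = {if x j = n then 1 else x j + 1, if x j = 1 then n else x j - 1}" (is "?T = ?S")
    if "j \<in> {1..d}" for j
  proof -
    have "t \<in> ?T \<longleftrightarrow> t \<in> {1..n} \<and> t \<noteq> x j \<and> t \<in> ?S" for t
      using vertices_torus_mem[OF x that] cong_diff_1_iff[of "x j" n t]
        cong_diff_neg_1_iff[of "x j" n t] by blast
    moreover have "?S \<subseteq> {1..n} - {x j}"
      using n vertices_torus_mem[OF x that] by auto
    ultimately show ?thesis by blast
  qed
  then have "neighbors (torus d n) x = (\<Union>j\<in>{1..d}. {torus_succ n j x, torus_pred n j x})"
    unfolding neighbors_torus_eq_UN[OF x] torus_succ_def torus_pred_def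
    by (intro SUP_cong) simp_all
  then show ?thesis by blast
qed

lemma fun_upd_eq_fun_upd_iff:
  assumes "s \<noteq> x i" "t \<noteq> x j"
  shows "x(i := s) = x(j := t) \<longleftrightarrow> i = j \<and> s = t"
proof
  assume eq: "x(i := s) = x(j := t)"
  show "i = j \<and> s = t"
    using fun_cong[OF eq, of i] fun_cong[OF eq, of j] assms by (auto split: if_splits)
qed simp

lemma card_torus_succ_pred:
  assumes n: "n \<ge> 3" and x: "\<And>j. j \<in> J \<union> K \<Longrightarrow> x j \<in> {1..n}" and fin: "finite J" "finite K"
  shows "card ((\<lambda>j. torus_succ n j x) ` J \<union> (\<lambda>j. torus_pred n j x) ` K) = card J + card K"
proof -
  have succ: "(if x j = n then 1 else x j + 1) \<noteq> x j" for j using n by auto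
  have pred: "(if x j = 1 then n else x j - 1) \<noteq> x j" if "j \<in> K" for j
    using n x[of j] that by auto
  have "inj_on (\<lambda>j. torus_succ n j x) J"
    unfolding inj_on_def torus_succ_def using succ by (simp add: fun_upd_eq_fun_upd_iff)
  moreover have "inj_on (\<lambda>j. torus_pred n j x) K"
    unfolding inj_on_def torus_pred_def using pred by (simp add: fun_upd_eq_fun_upd_iff)
  moreover have "torus_succ n i x \<noteq> torus_pred n j x" if "j \<in> K" for i j
    using fun_upd_eq_fun_upd_iff[of _ x i _ j, OF succ[of i] pred[OF that]] n x[of j] that
    unfolding torus_succ_def torus_pred_def by auto
  then have "(\<lambda>j. torus_succ n j x) ` J \<inter> (\<lambda>j. torus_pred n j x) ` K = {}" by blast
  ultimately show ?thesis
    using fin by (simp add: card_Un_disjoint card_image)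
qed

lemma degree_torus:
  assumes "n \<ge> 3" "x \<in> vertices (torus d n)"
  shows "degree (torus d n) x = 2 * d"
  using card_torus_succ_pred[of n "{1..d}" "{1..d}" x] neighbors_torus[of n x d]
    vertices_torus_mem[OF assms(2)] assms by (simp add: degree_def)

lemma card_filter_neighbors_torus_ge:
  assumes n: "n \<ge> 3" and x: "x \<in> vertices (torus d n)"
    and "J \<subseteq> {1..d}" "\<And>j. j \<in> J \<Longrightarrow> Q (torus_succ n j x)"
    and "K \<subseteq> {1..d}" "\<And>j. j \<in> K \<Longrightarrow> Q (torus_pred n j x)"
  shows "card J + card K \<le> card {u \<in> neighbors (torus d n) x. Q u}"
proof -
  have "finite J" "finite K" using assms finite_subset by blast+
  moreover have "x j \<in> {1..n}" if "j \<in> J \<union> K" for j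
    using that assms by (intro vertices_torus_mem[OF x]) auto
  ultimately have "card J + card K
      = card ((\<lambda>j. torus_succ n j x) ` J \<union> (\<lambda>j. torus_pred n j x) ` K)"
    using card_torus_succ_pred[OF n] by metis
  also have "\<dots> \<le> card {u \<in> neighbors (torus d n) x. Q u}"
    using assms neighbors_torus[of n x d]
    by (intro card_mono finite_subset[OF _ finite_neighbors[OF finite_vertices_torus]]) auto
  finally show ?thesis .
qed

subsection \<open>Level, weight and activation rank\<close>

definition level :: "nat \<Rightarrow> (nat \<Rightarrow> nat) \<Rightarrow> nat" where
  "level d x = (\<Sum>i\<in>{1..d}. x i)"

definition weight :: "nat \<Rightarrow> (nat \<Rightarrow> nat) \<Rightarrow> nat" where
  "weight d x = (\<Sum>i\<in>{1..d}. i * x i)"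

definition activation_rank :: "nat \<Rightarrow> (nat \<Rightarrow> nat) \<Rightarrow> int" where
  "activation_rank d x = 2 * int (weight d x) - (int (level d x mod (d + 2)))\<^sup>2"

lemma sum_mult_torus_succ:
  assumes "finite I" "j \<in> I" "x j \<noteq> n"
  shows "(\<Sum>i\<in>I. a i * torus_succ n j x i) = (\<Sum>i\<in>I. a i * x i) + a j"
proof -
  have "(\<Sum>i\<in>I. a i * torus_succ n j x i) = (\<Sum>i\<in>I. a i * x i + (if i = j then a i else 0))"
    using assms by (intro sum.cong) (auto simp: torus_succ_def)
  then show ?thesis using assms by (simp add: sum.distrib)
qed

lemma level_torus_succ:
  assumes "j \<in> {1..d}" "x j \<noteq> n"
  shows "level d (torus_succ n j x) = Suc (level d x)"
  using sum_mult_torus_succ[where x = x and a = "\<lambda>_. 1", OF _ assms] by (simp add: level_def)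

lemma weight_torus_succ:
  assumes "j \<in> {1..d}" "x j \<noteq> n"
  shows "weight d (torus_succ n j x) = weight d x + j"
  using sum_mult_torus_succ[where x = x and a = "\<lambda>i. i", OF _ assms] by (simp add: weight_def)

lemma level_torus_pred:
  assumes "j \<in> {1..d}" "x j \<in> {1<..n}"
  shows "level d x = Suc (level d (torus_pred n j x))"
  using level_torus_succ[OF assms(1), of "torus_pred n j x" n] torus_succ_pred[of x j n] assms
  by (auto simp: torus_pred_def)

lemma activation_rank_torus_succ:
  assumes "j \<in> {1..d}" "x j \<noteq> n" and "level d x mod (d + 2) \<le> d"
  shows "activation_rank d (torus_succ n j x)
    = activation_rank d x + 2 * int j - (2 * int (level d x mod (d + 2)) + 1)"
proof -
  have "level d (torus_succ n j x) mod (d + 2) = Suc (level d x mod (d + 2))"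
    using assms(3) by (simp add: level_torus_succ[where x = x, OF assms(1,2)] mod_Suc)
  then show ?thesis
    unfolding activation_rank_def weight_torus_succ[where x = x, OF assms(1,2)]
    by (simp add: power2_eq_square algebra_simps)
qed

lemma activation_rank_torus_pred:
  assumes "j \<in> {1..d}" "x j \<in> {1<..n}" and "level d x mod (d + 2) \<noteq> 0"
  shows "activation_rank d (torus_pred n j x)
    = activation_rank d x + (2 * int (level d x mod (d + 2)) - 1) - 2 * int j"
proof -
  let ?y = "torus_pred n j x"
  have "level d x mod (d + 2) = Suc (level d ?y mod (d + 2))"
    using assms(3) unfolding level_torus_pred[where x = x, OF assms(1,2)]
    by (simp add: mod_Suc split: if_splits)
  moreover have "level d x mod (d + 2) < d + 2" by simp
  moreover have "?y j \<noteq> n" "torus_succ n j ?y = x"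
    using assms(2) torus_succ_pred[of x j n] by (auto simp: torus_pred_def)
  ultimately show ?thesis
    using activation_rank_torus_succ[OF assms(1), of ?y n] by simp
qed

subsection \<open>The seed\<close>

definition seed_layers :: "nat \<Rightarrow> (nat \<Rightarrow> nat) set" where
  "seed_layers d = {x. level d x mod (d + 2) \<in> {0, d + 1}}"

definition box_boundary :: "nat \<Rightarrow> nat \<Rightarrow> (nat \<Rightarrow> nat) set" where
  "box_boundary d n = {x. \<exists>i\<in>{1..d}. x i \<in> {1, n}}"

definition seed :: "nat \<Rightarrow> nat \<Rightarrow> (nat \<Rightarrow> nat) set" where
  "seed d n = seed_layers d \<union> box_boundary d n"

lemma not_box_boundaryD:
  assumes "x \<in> vertices (torus d n)" "x \<notin> box_boundary d n" "j \<in> {1..d}"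
  shows "x j \<in> {1<..<n}"
proof -
  have "x j \<notin> {1, n}" using assms(2,3) unfolding box_boundary_def by blast
  then show ?thesis using vertices_torus_mem[OF assms(1,3)] by auto
qed

lemma card_neighbors_box_boundary_ge:
  assumes n: "n \<ge> 3" and x: "x \<in> vertices (torus d n)" "x \<in> box_boundary d n"
  shows "d \<le> card {u \<in> neighbors (torus d n) x. u \<in> box_boundary d n}"
proof -
  \<comment> \<open>Stepping down from \<open>1\<close> and up from every other value preserves \<open>{1, n}\<close>.\<close>
  define K where "K = {j \<in> {1..d}. x j = 1}"
  obtain i where i: "i \<in> {1..d}" "x i \<in> {1, n}"
    using x(2) by (auto simp: box_boundary_def)
  have "card ({1..d} - K) + card K \<le> card {u \<in> neighbors (torus d n) x. u \<in> box_boundary d n}"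
  proof (rule card_filter_neighbors_torus_ge[OF n x(1)])
    show "torus_succ n j x \<in> box_boundary d n" if "j \<in> {1..d} - K" for j
      using that i unfolding box_boundary_def K_def
      by (auto simp: torus_succ_def intro!: bexI[of _ i])
    show "torus_pred n j x \<in> box_boundary d n" if "j \<in> K" for j
      using that i unfolding box_boundary_def K_def
      by (auto simp: torus_pred_def intro!: bexI[of _ i])
  qed (auto simp: K_def)
  moreover have "K \<subseteq> {1..d}" by (auto simp: K_def)
  then have "card ({1..d} - K) + card K = d"
    using card_mono[of "{1..d}" K] by (simp add: card_Diff_subset finite_subset)
  ultimately show ?thesis by simp
qed

lemma card_neighbors_seed_layers_ge:
  assumes n: "n \<ge> 3" and x: "x \<in> vertices (torus d n)" "x \<notin> box_boundary d n"
    and layer: "x \<in> seed_layers d"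
  shows "d \<le> card {u \<in> neighbors (torus d n) x. u \<in> seed_layers d}"
proof -
  have inner: "x j \<in> {1<..<n}" if "j \<in> {1..d}" for j
    by (rule not_box_boundaryD[OF x that])
  consider "level d x mod (d + 2) = d + 1" | "level d x mod (d + 2) = 0"
    using layer by (auto simp: seed_layers_def)
  then show ?thesis
  proof cases
    case 1
    have "torus_succ n j x \<in> seed_layers d" if j: "j \<in> {1..d}" for j
    proof -
      have "level d (torus_succ n j x) = Suc (level d x)"
        using inner[OF j] by (intro level_torus_succ j) auto
      then show ?thesis using 1 by (simp add: seed_layers_def mod_Suc)
    qed
    then show ?thesis
      using card_filter_neighbors_torus_ge[OF n x(1), of "{1..d}" "\<lambda>u. u \<in> seed_layers d" "{}"]
      by simp
  next
    case 2
    have "torus_pred n j x \<in> seed_layers d" if j: "j \<in> {1..d}" for j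
    proof -
      have "level d x = Suc (level d (torus_pred n j x))"
        using inner[OF j] by (intro level_torus_pred j) auto
      then show ?thesis using 2 by (simp add: seed_layers_def mod_Suc split: if_splits)
    qed
    then show ?thesis
      using card_filter_neighbors_torus_ge[OF n x(1), of "{}" "\<lambda>u. u \<in> seed_layers d" "{1..d}"]
      by simp
  qed
qed

lemma card_neighbors_seed_ge:
  assumes "n \<ge> 3" "x \<in> vertices (torus d n)" "x \<in> seed d n"
  shows "d \<le> card {u \<in> neighbors (torus d n) x. u \<in> seed d n}"
proof -
  have "\<exists>S\<subseteq>seed d n. d \<le> card {u \<in> neighbors (torus d n) x. u \<in> S}"
    using card_neighbors_box_boundary_ge[OF assms(1,2)]
      card_neighbors_seed_layers_ge[OF assms(1,2)] assms(3) unfolding seed_def by blast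
  then obtain S where S: "S \<subseteq> seed d n" "d \<le> card {u \<in> neighbors (torus d n) x. u \<in> S}" by blast
  note S(2)
  also have "card {u \<in> neighbors (torus d n) x. u \<in> S}
      \<le> card {u \<in> neighbors (torus d n) x. u \<in> seed d n}"
    using S(1) finite_neighbors[OF finite_vertices_torus] by (intro card_mono) auto
  finally show ?thesis .
qed

lemma card_neighbors_smaller_rank_gt:
  assumes n: "n \<ge> 3" and x: "x \<in> vertices (torus d n)" "x \<notin> seed d n"
  shows "d < card {u \<in> neighbors (torus d n) x. activation_rank d u < activation_rank d x}"
    (is "_ < card ?N")
proof -
  define k where "k = level d x mod (d + 2)"
  have "k < d + 2" by (simp add: k_def)
  moreover have "k \<noteq> 0" "k \<noteq> d + 1"
    using x(2) by (auto simp: k_def seed_def seed_layers_def)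
  ultimately have k: "1 \<le> k" "k \<le> d" by linarith+
  have inner: "x j \<in> {1<..<n}" if "j \<in> {1..d}" for j
    using x(2) by (intro not_box_boundaryD[OF x(1) _ that]) (simp add: seed_def)
  have "card {1..k} + card {k..d} \<le> card ?N"
  proof (rule card_filter_neighbors_torus_ge[OF n x(1)])
    show "activation_rank d (torus_succ n j x) < activation_rank d x" if "j \<in> {1..k}" for j
      using activation_rank_torus_succ[of j d x n, folded k_def] inner[of j] k that by auto
    show "activation_rank d (torus_pred n j x) < activation_rank d x" if "j \<in> {k..d}" for j
      using activation_rank_torus_pred[of j d x n, folded k_def] inner[of j] k that by auto
  qed (use k in auto)
  then show ?thesis using k by simp
qed

lemma monotone_dynamo_seed:
  assumes n: "n \<ge> 3"
  shows "monotone_dynamo (torus d n) maj (indicator_config (torus d n) (seed d n))"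
proof (rule monotone_dynamo_indicator_config[where rank = "activation_rank d"])
  show "finite (vertices (torus d n))" by (rule finite_vertices_torus)
next
  fix x assume x: "x \<in> vertices (torus d n)" "x \<in> seed d n"
  show "degree (torus d n) x \<le> 2 * card {u \<in> neighbors (torus d n) x. u \<in> seed d n}"
    using card_neighbors_seed_ge[OF n x] degree_torus[OF n x(1)] by simp
next
  fix x assume x: "x \<in> vertices (torus d n)" "x \<notin> seed d n"
  let ?N = "neighbors (torus d n) x"
  have "card {u \<in> ?N. activation_rank d u < activation_rank d x}
      \<le> card {u \<in> ?N. u \<in> seed d n \<or> activation_rank d u < activation_rank d x}"
    using finite_neighbors[OF finite_vertices_torus] by (intro card_mono) auto
  then show "degree (torus d n) x
      < 2 * card {u \<in> ?N. u \<in> seed d n \<or> activation_rank d u < activation_rank d x}"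
    using card_neighbors_smaller_rank_gt[OF n x] degree_torus[OF n x(1)] by linarith
qed

subsection \<open>The size of the seed\<close>

lemma card_cong_atMost_le:
  fixes m n c r :: nat
  shows "card {t \<in> {..n}. [t + c = r] (mod m)} \<le> n div m + 1"
proof -
  let ?T = "{t \<in> {..n}. [t + c = r] (mod m)}"
  have "inj_on (\<lambda>t. t div m) ?T"
  proof (rule inj_onI)
    fix t u assume "t \<in> ?T" "u \<in> ?T" and div: "t div m = u div m"
    then have "[t + c = u + c] (mod m)"
      by (auto intro: cong_trans cong_sym)
    then have "t mod m = u mod m"
        by (simp only: cong_add_rcancel_nat) (simp add: cong_def)
    with div show "t = u" by (metis div_mult_mod_eq)
  qed
  then have "card ?T \<le> card {..n div m}"
    by (rule card_inj_on_le) (auto intro: div_le_mono)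
  then show ?thesis by simp
qed

lemma card_PiE_fibre_le:
  assumes "finite I" "i \<in> I" "finite A"
    and fibre: "\<And>x. x \<in> I - {i} \<rightarrow>\<^sub>E A \<Longrightarrow> card {t \<in> A. x(i := t) \<in> S} \<le> N"
  shows "card ((I \<rightarrow>\<^sub>E A) \<inter> S) \<le> N * card A ^ (card I - 1)"
proof -
  let ?X = "I - {i} \<rightarrow>\<^sub>E A" and ?T = "\<lambda>x. {t \<in> A. x(i := t) \<in> S}"
  have finX: "finite ?X" using assms by (intro finite_PiE) auto
  have "(I \<rightarrow>\<^sub>E A) \<inter> S \<subseteq> (\<lambda>(x, t). x(i := t)) ` (SIGMA x:?X. ?T x)"
    using PiE_insert_eq[of i "I - {i}" "\<lambda>_. A"] \<open>i \<in> I\<close> by (force simp: insert_absorb)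
  then have "card ((I \<rightarrow>\<^sub>E A) \<inter> S) \<le> card (SIGMA x:?X. ?T x)"
    using finX \<open>finite A\<close> by (intro surj_card_le) auto
  also have "\<dots> = (\<Sum>x\<in>?X. card (?T x))"
    using finX \<open>finite A\<close> by simp
  also have "\<dots> \<le> (\<Sum>x\<in>?X. N)"
    by (intro sum_mono fibre)
  also have "\<dots> = N * card A ^ (card I - 1)"
    using assms by (simp add: card_PiE)
  finally show ?thesis .
qed

lemma card_sum_cong_le:
  fixes m n r :: nat
  assumes "finite I" "I \<noteq> {}"
  shows "card ((I \<rightarrow>\<^sub>E {1..n}) \<inter> {x. [sum x I = r] (mod m)}) \<le> (n div m + 1) * n ^ (card I - 1)"
proof -
  obtain i where i: "i \<in> I" using assms(2) by blast
  let ?S = "{x. [sum x I = r] (mod m)}"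
  have "card {t \<in> {1..n}. x(i := t) \<in> ?S} \<le> n div m + 1" for x
  proof -
    have "sum (x(i := t)) I = t + sum x (I - {i})" for t
      using assms(1) i by (subst sum.remove[of I i]) (auto intro: sum.cong)
    then have "card {t \<in> {1..n}. x(i := t) \<in> ?S}
        \<le> card {t \<in> {..n}. [t + sum x (I - {i}) = r] (mod m)}"
      by (intro card_mono) auto
    also have "\<dots> \<le> n div m + 1" by (rule card_cong_atMost_le)
    finally show ?thesis .
  qed
  from card_PiE_fibre_le[OF assms(1) i _ this] show ?thesis by simp
qed

lemma card_PiE_meets_le:
  assumes "finite I" "finite A" "finite B"
  shows "card ((I \<rightarrow>\<^sub>E A) \<inter> {x. \<exists>i\<in>I. x i \<in> B}) \<le> card I * (card B * card A ^ (card I - 1))"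
proof -
  have "(I \<rightarrow>\<^sub>E A) \<inter> {x. \<exists>i\<in>I. x i \<in> B} = (\<Union>i\<in>I. (I \<rightarrow>\<^sub>E A) \<inter> {x. x i \<in> B})"
    by blast
  also have "card \<dots> \<le> (\<Sum>i\<in>I. card ((I \<rightarrow>\<^sub>E A) \<inter> {x. x i \<in> B}))"
    using assms(1) by (rule card_UN_le)
  also have "\<dots> \<le> (\<Sum>i\<in>I. card B * card A ^ (card I - 1))"
  proof (intro sum_mono card_PiE_fibre_le assms)
    show "card {t \<in> A. x(i := t) \<in> {x. x i \<in> B}} \<le> card B" for x and i :: 'a
      using assms(3) by (intro card_mono) auto
  qed
  also have "\<dots> = card I * (card B * card A ^ (card I - 1))" by simp
  finally show ?thesis .
qed

lemma card_seed_le: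
  assumes "d \<ge> 1"
  shows "card (vertices (torus d n) \<inter> seed d n)
    \<le> (2 * (n div (d + 2)) + 2 * d + 2) * n ^ (d - 1)"
proof -
  let ?V = "vertices (torus d n)"
  let ?L = "\<lambda>r. ?V \<inter> {x. [level d x = r] (mod (d + 2))}"
  have layer: "card (?L r) \<le> (n div (d + 2) + 1) * n ^ (d - 1)" for r
    using card_sum_cong_le[of "{1..d}" n r "d + 2"] assms by (simp add: vertices_torus level_def)
  have "card (?V \<inter> box_boundary d n) \<le> d * (card {1, n} * n ^ (d - 1))"
    using card_PiE_meets_le[of "{1..d}" "{1..n}" "{1, n}"]
    by (simp add: vertices_torus box_boundary_def)
  also have "\<dots> \<le> d * (2 * n ^ (d - 1))"
    by (intro mult_left_mono mult_right_mono) (auto simp: card_insert_if)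
  finally have boundary: "card (?V \<inter> box_boundary d n) \<le> d * (2 * n ^ (d - 1))" .
  have "?V \<inter> seed d n = (?L 0 \<union> ?L (d + 1)) \<union> ?V \<inter> box_boundary d n"
    by (auto simp: seed_def seed_layers_def cong_def)
  then have "card (?V \<inter> seed d n) \<le> card (?L 0 \<union> ?L (d + 1)) + card (?V \<inter> box_boundary d n)"
    by (simp only: card_Un_le)
  also have "card (?L 0 \<union> ?L (d + 1)) \<le> card (?L 0) + card (?L (d + 1))"
    by (rule card_Un_le)
  finally have "card (?V \<inter> seed d n)
      \<le> card (?L 0) + card (?L (d + 1)) + card (?V \<inter> box_boundary d n)"
    by simp
  with layer[of 0] layer[of "d + 1"] boundary show ?thesis
    by (simp add: algebra_simps)
qed

lemma m_mon_torus_le: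
  assumes "d \<ge> 1" "n \<ge> 3"
  shows "m_mon (torus d n) maj \<le> (2 * (n div (d + 2)) + 2 * d + 2) * n ^ (d - 1)"
  using m_mon_le_config_size[OF monotone_dynamo_seed[OF assms(2)]] card_seed_le[OF assms(1)]
  unfolding config_size_indicator_config by (rule order_trans)

theorem theorem7:
  fixes d :: nat
  assumes "d \<ge> 1"
  shows "\<exists>C::real. C > 0 \<and> (\<exists>n\<^sub>0::nat. \<forall>n\<ge>n\<^sub>0.
           real (m_mon (torus d n) maj)
             \<le> (1 - real d / (real d + 2)) * real n ^ d + C * real n ^ (d - 1))"
proof (intro exI[of _ "2 * real d + 2"] exI[of _ 3] conjI allI impI)
  fix n :: nat assume "n \<ge> 3"
  have "real (m_mon (torus d n) maj) \<le> real ((2 * (n div (d + 2)) + 2 * d + 2) * n ^ (d - 1))"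
    using m_mon_torus_le[OF assms \<open>n \<ge> 3\<close>] by (simp only: of_nat_le_iff)
  also have "\<dots> = (2 * real (n div (d + 2)) + 2 * real d + 2) * real n ^ (d - 1)"
    by (simp add: algebra_simps)
  also have "\<dots> \<le> (2 * (real n / (real d + 2)) + 2 * real d + 2) * real n ^ (d - 1)"
    using of_nat_div_le_of_nat[where 'a = real, of n "d + 2"]
    by (intro mult_right_mono add_right_mono mult_left_mono) (auto simp: add.commute)
  also have "\<dots> = 2 / (real d + 2) * (real n * real n ^ (d - 1))
      + (2 * real d + 2) * real n ^ (d - 1)"
    by (simp add: algebra_simps)
  also have "\<dots> = (1 - real d / (real d + 2)) * real n ^ d + (2 * real d + 2) * real n ^ (d - 1)"
    using assms by (simp add: field_simps flip: power_Suc)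
  finally show "real (m_mon (torus d n) maj)
      \<le> (1 - real d / (real d + 2)) * real n ^ d + (2 * real d + 2) * real n ^ (d - 1)" .
qed simp

end
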